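(* Let $p$ be a prime with $p\equiv 3\pmod 4$, let $n=\lfloor\sqrt{p}\rfloor$, and let $\sqrt{p}=\langle n,\overline{a_1,a_2,\ldots,a_{l-1},2n}\rangle$ be the regular continued fraction of $\sqrt{p}$, with (even) period length $l$. Then the central term $a_{\frac{l}{2}}$ is odd, and it is equal to either $n$ or $n-1$.
   Context: For a prime $p$, the regular continued fraction of $\sqrt{p}$ has the form $\sqrt{p}=\langle n,\overline{a_1,a_2,\ldots,a_{l-1},2n}\rangle$, where $n=\lfloor\sqrt{p}\rfloor$, the bar denotes the repeating block, $l$ is the length of the (minimal) period, and $a_i=a_{l-i}$ for $1\le i\le l-1$. When $p\equiv 3 \pmod 4$, $l$ is even. *)

theory Defs
  imports Complex_Main "HOL-Number_Theory.Cong"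
begin

text \<open>
  The regular continued fraction \<open>x = \<langle>a\<^sub>0, a\<^sub>1, a\<^sub>2, \<dots>\<rangle>\<close> of an irrational \<open>x\<close>:
  \<open>a\<^sub>k\<close> is the floor of the \<open>k\<close>-th complete quotient \<open>x\<^sub>k\<close>, where \<open>x\<^sub>0 = x\<close> and
  \<open>x\<^sub>k = a\<^sub>k + 1 / x\<^sub>k\<^sub>+\<^sub>1\<close>.
  For rational \<open>x\<close> the expansion terminates; since \<open>1 / 0 = 0\<close>, the sequence below
  is then padded with zeros.
\<close>

primrec cf_quotient :: "real \<Rightarrow> nat \<Rightarrow> real" where
  "cf_quotient x 0 = x"
| "cf_quotient x (Suc k) = 1 / frac (cf_quotient x k)"

definition cf_term :: "real \<Rightarrow> nat \<Rightarrow> int" where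
  "cf_term x k = \<lfloor>cf_quotient x k\<rfloor>"

text \<open>
  The repeating block starts directly after the integer part:
  \<open>l\<close> is a period length iff \<open>x = \<langle>a\<^sub>0, a\<^sub>1, \<dots>, a\<^sub>l, a\<^sub>1, \<dots>, a\<^sub>l, \<dots>\<rangle>\<close>.
  If there is no such \<open>l\<close>, then \<open>cf_period_length x\<close> is unspecified.
\<close>

definition cf_period_length :: "real \<Rightarrow> nat" where
  "cf_period_length x =
     (LEAST l. l > 0 \<and> (\<forall>k\<ge>1. cf_term x (k + l) = cf_term x k))"

end

theory Submission
  imports Defs "HOL-Computational_Algebra.Polynomial"
begin

text \<open>
  The complete quotients of \<open>\<surd>d\<close> with positive index have the form
  \<open>(P\<^sub>k + \<surd>d) / Q\<^sub>k\<close> with integers satisfying \<open>P\<^sub>k\<^sup>2 + Q\<^sub>k\<^sub>-\<^sub>1 Q\<^sub>k = d\<close>. The whole argument rests on a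
  time-reversal symmetry of these data. Consider the triple \<open>(Q\<^sub>k\<^sub>-\<^sub>1, P\<^sub>k, Q\<^sub>k)\<close>. One step of the
  algorithm replaces \<open>P\<^sub>k\<close> by the unique integer congruent to \<open>-P\<^sub>k\<close> modulo \<open>Q\<^sub>k\<close> in a window of
  length \<open>Q\<^sub>k\<close> below \<open>\<surd>d\<close>, and for a reduced triple \<open>P\<^sub>k\<close> itself lies in that same window. Hence
  swapping the outer entries turns a step into a step back (\<open>step_reversal_step\<close>). In
  particular the step is injective on the finite set of reduced triples, so the orbit of
  \<open>(d - r\<^sup>2, r, 1)\<close>, where \<open>r\<close> is the integer part of \<open>\<surd>d\<close>, is purely periodic; this initial triple
  belongs to \<open>r + \<surd>d\<close>, whose expansion agrees with that of \<open>\<surd>d\<close> after the integer part. Its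
  successor is its own mirror image, and therefore the whole period is a palindrome
  (\<open>state_reflection\<close>).

  Reading the symmetry at the middle of the period of length \<open>l\<close> gives two cases.
  For odd \<open>l\<close>, a triple equals its mirror image, so \<open>Q\<^sub>k\<^sub>-\<^sub>1 = Q\<^sub>k\<close> and \<open>d\<close> is a sum of two squares,
  which is impossible modulo 4 (\<open>odd_period_sum_two_squares\<close>, \<open>sum_two_squares_mod_4\<close>).
  For \<open>l = 2m\<close>, the triples at \<open>m\<close> and \<open>m + 1\<close> are mirror images, so \<open>P\<^sub>m = P\<^sub>m\<^sub>+\<^sub>1 = a\<^sub>m Q\<^sub>m - P\<^sub>m\<close>, that
  is \<open>2 P\<^sub>m = a\<^sub>m Q\<^sub>m\<close> (\<open>even_period_centre\<close>). Then \<open>Q\<^sub>m\<close> divides \<open>4p\<close>, and for a prime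
  \<open>p \<equiv> 3 (mod 4)\<close> this leaves only \<open>Q\<^sub>m = 2\<close>, the value 1 being excluded by the minimality of the
  period (\<open>central_denominator\<close>). So \<open>a\<^sub>m = P\<^sub>m\<close>, which is odd because \<open>p - P\<^sub>m\<^sup>2\<close> is even, and
  reducedness, \<open>P\<^sub>m \<le> r < P\<^sub>m + 2\<close>, leaves the two values \<open>r\<close> and \<open>r - 1\<close>.

  The period in question is defined through the partial quotients, whereas the symmetry concerns
  the triples. The two notions of period agree (\<open>term_period_iff_state_period\<close>).
\<close>

section \<open>States of the continued fraction algorithm\<close>

text \<open>
  A state \<open>(A, P, B)\<close> encodes the complete quotient \<open>(P + \<surd>d) / B\<close>. Its first entry is the previous
  denominator: it is determined by \<open>A B = d - P\<^sup>2\<close>, but keeping it makes time reversal a mere swap.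
\<close>

type_synonym cf_state = "int \<times> int \<times> int"

fun reversal :: "cf_state \<Rightarrow> cf_state" where
  "reversal (A, P, B) = (B, P, A)"

locale sqrt_cf =
  fixes d :: int
  assumes nonneg: "d \<ge> 0"
    and nonsquare: "sqrt (of_int d) \<notin> \<int>"
begin

abbreviation s :: real where "s \<equiv> sqrt (of_int d)"

definition r :: int where "r = \<lfloor>s\<rfloor>"

lemma irrational: "s \<notin> \<rat>"
proof
  assume "s \<in> \<rat>"
  moreover have "algebraic_int s"
    by (intro algebraic_int_sqrt) auto
  ultimately show False
    using nonsquare rational_algebraic_int_is_int by blast
qed

lemma r_bounds: "r \<ge> 0" "of_int r < s" "s < of_int r + 1"
proof -
  show "r \<ge> 0"
    using nonneg by (simp add: r_def)
  have "of_int r \<noteq> s"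
    using nonsquare Ints_of_int by metis
  then show "of_int r < s" "s < of_int r + 1"
    unfolding r_def by linarith+
qed

lemma r_square: "r\<^sup>2 < d" "d < (r + 1)\<^sup>2"
proof -
  have s2: "s\<^sup>2 = of_int d"
    using nonneg by simp
  have "(of_int r)\<^sup>2 < s\<^sup>2" "s\<^sup>2 < (of_int r + 1)\<^sup>2"
    using r_bounds nonneg by (auto intro!: power_strict_mono simp del: real_sqrt_pow2)
  then have "real_of_int (r\<^sup>2) < of_int d" "real_of_int d < of_int ((r + 1)\<^sup>2)"
    unfolding s2 by simp_all
  then show "r\<^sup>2 < d" "d < (r + 1)\<^sup>2"
    by (simp_all only: of_int_less_iff)
qed

definition partial_quotient :: "cf_state \<Rightarrow> int" where
  "partial_quotient = (\<lambda>(A, P, B). (P + r) div B)"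

text \<open>
  Taking out \<open>q\<close> from \<open>(P + \<surd>d) / B\<close> and inverting gives \<open>B / (\<surd>d - P') = (P' + \<surd>d) / B'\<close> with
  \<open>P' = q B - P\<close> and \<open>B B' = d - P'\<^sup>2\<close>. Since \<open>r\<close> may replace \<open>\<surd>d\<close> under the floor, everything stays
  within the integers.
\<close>

fun step :: "cf_state \<Rightarrow> cf_state" where
  "step (A, P, B) =
     (let P' = (P + r) div B * B - P in (B, P', (d - P'\<^sup>2) div B))"

text \<open>
  The condition on \<open>B\<close> puts \<open>P\<close> into the window \<open>r - B < P \<le> r\<close>, which says that the conjugate
  \<open>(P - \<surd>d) / B\<close> lies between -1 and 0. The condition on \<open>A\<close> is the same for the mirror image; given
  the norm equation it says that the complete quotient exceeds 1. Stating both makes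
  reducedness visibly invariant under reversal.
\<close>

fun reduced :: "cf_state \<Rightarrow> bool" where
  "reduced (A, P, B) \<longleftrightarrow>
     A > 0 \<and> B > 0 \<and> A * B = d - P\<^sup>2 \<and> P \<le> r \<and> r < P + A \<and> r < P + B"

text \<open>
  Otherwise both outer entries exceed \<open>r\<close>, and their product would be too large.
\<close>

lemma reduced_pos:
  assumes "reduced (A, P, B)"
  shows "P > 0"
proof (rule ccontr)
  assume "\<not> P > 0"
  then have "(r + 1) * (r + 1) \<le> A * B"
    using assms r_bounds(1) by (intro mult_mono) auto
  also have "\<dots> \<le> d"
    using assms by simp
  finally show False
    using r_square by (simp add: power2_eq_square)
qed

text \<open>
  Otherwise \<open>A B\<close> would be at least \<open>(r + 1 - P) (r + 1 + P) = (r + 1)\<^sup>2 - P\<^sup>2 > d - P\<^sup>2\<close>.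
\<close>

lemma reduced_quotient_ge_1:
  assumes "reduced (A, P, B)"
  shows "B \<le> P + r"
proof (rule ccontr)
  assume "\<not> B \<le> P + r"
  then have "(r - P + 1) * (r + P + 1) \<le> A * B"
    using assms r_bounds(1) reduced_pos[OF assms] by (intro mult_mono) auto
  also have "\<dots> = d - P\<^sup>2"
    using assms by simp
  finally have "(r + 1)\<^sup>2 \<le> d"
    by (simp add: power2_eq_square algebra_simps)
  then show False
    using r_square by simp
qed

text \<open>
  The window for \<open>P'\<close> is that of a remainder modulo \<open>B\<close>. The two inequalities that need an argument
  are \<open>B' > 0\<close>, which follows from \<open>\<bar>P'\<bar> \<le> r\<close>, and \<open>r < P' + B'\<close>, which follows from \<open>q \<ge> 1\<close> and
  \<open>P \<le> r\<close>.
\<close>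

lemma step_reduced:
  assumes "reduced (A, P, B)"
  obtains P' B' where "step (A, P, B) = (B, P', B')"
    and "P' = (P + r) div B * B - P" and "reduced (B, P', B')"
proof -
  define q where "q = (P + r) div B"
  define P' where "P' = q * B - P"
  have red: "A > 0" "B > 0" "A * B = d - P\<^sup>2" "P \<le> r" "r < P + A" "r < P + B"
    using assms by auto
  have "q * B + (P + r) mod B = P + r" "(P + r) mod B < B" "0 \<le> (P + r) mod B"
    unfolding q_def using red by auto
  then have P'_bounds: "P' \<le> r" "r < P' + B"
    unfolding P'_def by linarith+
  have q_pos: "q \<ge> 1"
    unfolding q_def using reduced_quotient_ge_1[OF assms] red(2)
    by (simp add: int_one_le_iff_zero_less pos_imp_zdiv_pos_iff)
  have P'_lower: "- r < P'"
    using P'_bounds reduced_quotient_ge_1[OF assms] red(4) by linarith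
  \<comment> \<open>The quotient \<open>(d - P'\<^sup>2) / B\<close>, written so that its integrality is evident.\<close>
  define B' where "B' = A + q * (2 * P - q * B)"
  have BB': "B * B' = d - P'\<^sup>2"
    using red(3) unfolding B'_def P'_def by algebra
  have "P'\<^sup>2 \<le> r\<^sup>2"
    using P'_bounds P'_lower r_bounds(1) by (simp flip: abs_le_square_iff)
  then have "B * B' > 0"
    using BB' r_square by simp
  then have B'_pos: "B' > 0"
    using red(2) by (simp add: zero_less_mult_iff)
  have "r < P' + B'"
  proof (rule ccontr)
    assume "\<not> r < P' + B'"
    then have le: "B' \<le> r - P'" by simp
    have "q * B \<ge> 1 * B"
      using q_pos red(2) by (intro mult_right_mono) auto
    then have "B \<le> r + P'"
      unfolding P'_def using red(4) by simp
    then have "B * B' \<le> (r + P') * (r - P')"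
      using le red(2) B'_pos P'_lower by (intro mult_mono) auto
    also have "\<dots> = r\<^sup>2 - P'\<^sup>2"
      by (simp add: power2_eq_square algebra_simps)
    finally show False
      using BB' r_square by simp
  qed
  then have "reduced (B, P', B')"
    using red B'_pos BB' P'_bounds by auto
  moreover have "step (A, P, B) = (B, P', B')"
    using BB' red(2) by (simp add: Let_def flip: q_def P'_def) (metis BB' nonzero_mult_div_cancel_left less_irrefl)
  ultimately show ?thesis
    using that P'_def q_def by blast
qed

section \<open>Reflection symmetry of the orbit\<close>

lemma reduced_step: "reduced t \<Longrightarrow> reduced (step t)"
  by (cases t) (metis step_reduced)

lemma reduced_reversal: "reduced t \<Longrightarrow> reduced (reversal t)"
  by (cases t) (auto simp: mult.commute)

lemma reversal_reversal [simp]: "reversal (reversal t) = t"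
  by (cases t) auto

text \<open>
  Since \<open>P + P' = q B\<close>, the two middle entries determine each other by the same rule: each is
  the representative of the negative of the other modulo \<open>B\<close> in the window \<open>(r - B, r]\<close>.
\<close>

lemma step_reversal_step:
  assumes "reduced t"
  shows "step (reversal (step t)) = reversal t"
proof -
  obtain A P B where t: "t = (A, P, B)" by (cases t)
  obtain P' B' where st: "step t = (B, P', B')" and P': "P' = (P + r) div B * B - P"
    using step_reduced assms unfolding t by metis
  have red: "B > 0" "A * B = d - P\<^sup>2" "P \<le> r" "r < P + B"
    using assms t by auto
  have "P' + r = (r - P) + (P + r) div B * B"
    unfolding P' by simp
  then have "(P' + r) div B = (P + r) div B"
    using red by (simp only: div_mult_self3) simp
  then have "(P' + r) div B * B - P' = P"
    unfolding P' by simp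
  moreover have "(d - P\<^sup>2) div B = A"
    using red by (metis nonzero_mult_div_cancel_right less_irrefl)
  ultimately show ?thesis
    unfolding st by (simp add: t Let_def)
qed

lemma step_inj:
  assumes "reduced t" "reduced u" "step t = step u"
  shows "t = u"
  by (metis assms reversal_reversal step_reversal_step)

text \<open>
  The orbit starts at the state of \<open>r + \<surd>d\<close> rather than \<open>\<surd>d\<close>: the latter is not reduced,
  while both have the same fractional part and hence the same later complete quotients.
\<close>

definition state :: "nat \<Rightarrow> cf_state" where
  "state k = (step ^^ k) (d - r\<^sup>2, r, 1)"

lemma state_Suc: "state (Suc k) = step (state k)"
  by (simp add: state_def)

lemma reduced_state: "reduced (state k)"
proof (induction k)
  case 0
  then show ?case
    using r_square r_bounds by (simp add: state_def)
next
  case (Suc k)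
  then show ?case
    by (simp add: state_Suc reduced_step)
qed

text \<open>
  The axis of the symmetry: the first partial quotient is \<open>2 r\<close>, so \<open>P\<close> keeps the value \<open>r\<close>.
\<close>

lemma state_1: "state 1 = reversal (state 0)"
  by (simp add: state_def Let_def)

text \<open>
  Injectivity of the step lets a coincidence be traced back to the start, so the orbit has no
  preperiod.
\<close>

lemma state_eq_cancel:
  assumes "state (i + k) = state k"
  shows "state i = state 0"
  using assms
  by (induction k) (auto simp: state_Suc dest: step_inj[OF reduced_state reduced_state])

lemma state_periodic:
  assumes "state l = state 0"
  shows "state (k + l) = state k"
  using assms by (simp add: state_def funpow_add)

text \<open>
  The outer entries are positive divisors of \<open>d - P\<^sup>2 \<le> d\<close>, and \<open>P\<close> lies within \<open>A \<le> d\<close> below \<open>r\<close>.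
\<close>

lemma finite_reduced: "finite {t. reduced t}"
proof (rule finite_subset)
  show "{t. reduced t} \<subseteq> {0..d} \<times> {-d..r} \<times> {0..d}"
  proof
    fix t assume "t \<in> {t. reduced t}"
    moreover obtain A P B where t: "t = (A, P, B)" by (cases t)
    ultimately have red: "A > 0" "B > 0" "A * B = d - P\<^sup>2" "P \<le> r" "r < P + A"
      by auto
    have "A * 1 \<le> A * B" "1 * B \<le> A * B"
      using red by (intro mult_mono; simp)+
    then have "A \<le> d" "B \<le> d"
      using red(3) zero_le_power2[of P] by linarith+
    then show "t \<in> {0..d} \<times> {-d..r} \<times> {0..d}"
      using red r_bounds(1) by (simp add: t)
  qed
qed auto

lemma period_exists:
  obtains L where "L > 0" "state L = state 0"
proof -
  have "finite (range state)"
    using finite_reduced by (rule finite_subset[rotated]) (use reduced_state in auto)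
  then have "\<not> inj state"
    using finite_imageD by blast
  then obtain i j where "i < j" "state i = state j"
    by (metis linorder_injI)
  then have "state (j - i) = state 0"
    using state_eq_cancel[of "j - i" i] by simp
  then show ?thesis
    using that[of "j - i"] \<open>i < j\<close> by simp
qed

text \<open>
  Both sides agree for \<open>j = 0\<close>, as \<open>state 1\<close> is the mirror image of \<open>state 0\<close>. Increasing \<open>j\<close> moves
  the left-hand side one step back, and the right-hand side too, because reversal inverts the
  direction of time.
\<close>

lemma state_reflection:
  assumes "state l = state 0" "j \<le> l"
  shows "state (l - j) = reversal (state (Suc j))"
  using assms(2)
proof (induction j)
  case 0
  then show ?case
    using assms(1) state_1 by simp
next
  case (Suc j)
  have "Suc (l - Suc j) = l - j"
    using Suc.prems by simp
  then have "step (state (l - Suc j)) = reversal (state (Suc j))"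
    using Suc by (metis Suc_leD state_Suc)
  also have "\<dots> = step (reversal (state (Suc (Suc j))))"
    using step_reversal_step[OF reduced_state[of "Suc j"]] by (simp add: state_Suc)
  finally show ?case
    using step_inj reduced_state reduced_reversal by blast
qed

section \<open>From states to the continued fraction\<close>

definition state_value :: "cf_state \<Rightarrow> real" where
  "state_value = (\<lambda>(A, P, B). (of_int P + s) / of_int B)"

lemma floor_state_value:
  assumes "reduced t"
  shows "\<lfloor>state_value t\<rfloor> = partial_quotient t"
proof -
  obtain A P B where t: "t = (A, P, B)" by (cases t)
  have "\<lfloor>(of_int P + s) / of_int B\<rfloor> = \<lfloor>of_int P + s\<rfloor> div B"
    using assms by (intro floor_divide_real_eq_div) (simp add: t)
  then show ?thesis
    by (simp add: t state_value_def partial_quotient_def r_def)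
qed

lemma state_value_gt_1:
  assumes "reduced t"
  shows "state_value t > 1"
proof -
  obtain A P B where t: "t = (A, P, B)" by (cases t)
  have "real_of_int B \<le> of_int (P + r)"
    using reduced_quotient_ge_1 assms unfolding t of_int_le_iff by blast
  then have "real_of_int B < of_int P + s"
    using r_bounds by simp
  then show ?thesis
    using assms by (simp add: t state_value_def)
qed

lemma state_value_step:
  assumes "reduced t"
  shows "state_value (step t) = 1 / frac (state_value t)"
proof -
  obtain A P B where t: "t = (A, P, B)" by (cases t)
  obtain P' B' where st: "step t = (B, P', B')" and P': "P' = (P + r) div B * B - P"
    and red': "reduced (B, P', B')"
    using step_reduced assms unfolding t by metis
  have pos: "B > 0" "B' > 0" "P' \<le> r"
    using red' by auto
  have "real_of_int (B * B') = of_int (d - P'\<^sup>2)"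
    using red' by simp
  also have "\<dots> = s\<^sup>2 - (of_int P')\<^sup>2"
    using nonneg by simp
  finally have prod: "real_of_int B * of_int B' = (s + of_int P') * (s - of_int P')"
    by (simp add: power2_eq_square algebra_simps)
  have "real_of_int P' \<le> of_int r"
    using pos by simp
  then have nz: "s - of_int P' \<noteq> 0"
    using r_bounds by linarith
  have "frac (state_value t) = (of_int P + s) / of_int B - of_int ((P + r) div B)"
    using floor_state_value[OF assms] by (simp add: frac_def t state_value_def partial_quotient_def)
  also have "\<dots> = (s - of_int P') / of_int B"
    using pos by (simp add: P' field_simps)
  finally have "1 / frac (state_value t) = of_int B / (s - of_int P')"
    by simp
  also have "\<dots> = (of_int P' + s) / of_int B'"
    using prod nz pos by (simp add: divide_simps)
  finally show ?thesis
    by (simp add: st state_value_def)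
qed

text \<open>
  By irrationality of \<open>\<surd>d\<close> the value determines \<open>P\<close> and \<open>B\<close>, and the norm equation gives \<open>A\<close>.
\<close>

lemma state_value_inj:
  assumes "reduced t" "reduced u" "state_value t = state_value u"
  shows "t = u"
proof -
  obtain A P B where t: "t = (A, P, B)" by (cases t)
  obtain A' P' B' where u: "u = (A', P', B')" by (cases u)
  have pos: "B > 0" "B' > 0"
    using assms t u by auto
  have eq: "s * of_int (B' - B) = of_int (P' * B - P * B')"
    using assms(3) pos by (simp add: t u state_value_def field_simps)
  have B: "B = B'"
  proof (rule ccontr)
    assume "B \<noteq> B'"
    then have "s = of_int (P' * B - P * B') / of_int (B' - B)"
      using eq by (simp add: field_simps)
    then show False
      using irrational by (metis Rats_divide Rats_of_int)
  qed
  have P: "P = P'"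
    using eq pos by (simp add: B)
  have "A * B = A' * B"
    using assms(1,2) by (auto simp: t u B P)
  then show ?thesis
    using pos by (simp add: t u B P)
qed

lemma cf_quotient_sqrt: "cf_quotient s (Suc k) = state_value (state (Suc k))"
proof (induction k)
  case 0
  have "state_value (state 0) = s + of_int r"
    by (simp add: state_value_def state_def)
  then have "frac (state_value (state 0)) = frac s"
    by (simp add: frac_def)
  then show ?case
    by (simp add: state_Suc state_value_step[OF reduced_state])
next
  case (Suc k)
  then show ?case
    using state_value_step[OF reduced_state[of "Suc k"]] by (simp add: state_Suc)
qed

lemma cf_term_sqrt:
  assumes "k \<ge> 1"
  shows "cf_term s k = partial_quotient (state k)"
  using assms cf_quotient_sqrt[of "k - 1"] floor_state_value[OF reduced_state]
  by (simp add: cf_term_def)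

text \<open>
  For the nontrivial direction, let \<open>y\<^sub>k\<close> be the complete quotients and suppose that
  \<open>y\<^sub>k\<close> and \<open>y\<^sub>k\<^sub>+\<^sub>l\<close> always have the same floor. Passing to the next index multiplies the distance
  \<open>\<bar>y\<^sub>k\<^sub>+\<^sub>l - y\<^sub>k\<bar>\<close> by \<open>y\<^sub>k\<^sub>+\<^sub>1 y\<^sub>k\<^sub>+\<^sub>l\<^sub>+\<^sub>1 > 1\<close>. A nonzero distance would thus grow strictly for ever, but it
  is periodic, as the orbit of states is. This replaces the convergence of continued fractions.
\<close>

lemma term_period_iff_state_period:
  "(\<forall>k\<ge>1. cf_term s (k + l) = cf_term s k) \<longleftrightarrow> state l = state 0"
proof
  assume "state l = state 0"
  then show "\<forall>k\<ge>1. cf_term s (k + l) = cf_term s k"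
    by (simp add: cf_term_sqrt state_periodic)
next
  assume per: "\<forall>k\<ge>1. cf_term s (k + l) = cf_term s k"
  define y where "y k = state_value (state k)" for k
  define e where "e k = \<bar>y (k + l) - y k\<bar>" for k
  have y_gt_1: "y k > 1" for k
    unfolding y_def by (rule state_value_gt_1[OF reduced_state])
  have grow: "e (Suc k) = e k * (y (Suc k) * y (Suc k + l))" if "k \<ge> 1" for k
  proof -
    have inv: "1 / y (Suc i) = frac (y i)" for i
      by (simp add: y_def state_Suc state_value_step reduced_state)
    have "\<lfloor>y (k + l)\<rfloor> = \<lfloor>y k\<rfloor>"
      using per that by (simp add: y_def cf_term_sqrt floor_state_value reduced_state)
    then have "y (k + l) - y k = 1 / y (Suc k + l) - 1 / y (Suc k)"
      unfolding inv add_Suc by (simp add: frac_def)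
    also have "\<dots> = - (y (Suc k + l) - y (Suc k)) / (y (Suc k) * y (Suc k + l))"
      using y_gt_1[of "Suc k"] y_gt_1[of "Suc k + l"] by (simp add: field_simps)
    finally have "e k = e (Suc k) / (y (Suc k) * y (Suc k + l))"
      unfolding e_def using y_gt_1[of "Suc k"] y_gt_1[of "Suc k + l"]
      by (simp add: abs_mult)
    then show ?thesis
      using y_gt_1[of "Suc k"] y_gt_1[of "Suc k + l"] by (simp add: field_simps)
  qed
  have "e 1 = 0"
  proof (rule ccontr)
    assume "e 1 \<noteq> 0"
    then have e1: "e 1 > 0"
      by (simp add: e_def)
    have inc: "e 1 \<le> e (Suc k) \<and> e (Suc k) < e (Suc (Suc k))" for k
    proof (induction k)
      case 0
      then show ?case
        using e1 grow[of 1] less_1_mult[OF y_gt_1 y_gt_1] by simp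
    next
      case (Suc k)
      then have "e 1 \<le> e (Suc (Suc k))" by simp
      moreover from this have "e (Suc (Suc k)) < e (Suc (Suc (Suc k)))"
        using e1 grow[of "Suc (Suc k)"] less_1_mult[OF y_gt_1 y_gt_1] by simp
      ultimately show ?case by simp
    qed
    obtain L where L: "L > 0" "state L = state 0"
      by (rule period_exists)
    have "e 1 < e (1 + L)"
      using inc[of "L - 1"] L(1) by simp
    moreover have "e (1 + L) = e 1"
      using state_periodic[OF L(2), of 1] state_periodic[OF L(2), of "1 + l"]
      by (simp add: e_def y_def add.commute add.left_commute)
    ultimately show False by simp
  qed
  then have "state (l + 1) = state 1"
    using state_value_inj[OF reduced_state reduced_state] by (simp add: e_def y_def)
  then show "state l = state 0"
    by (rule state_eq_cancel)
qed

lemma cf_period_length_sqrt: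
  shows "cf_period_length s > 0" "state (cf_period_length s) = state 0"
    and "\<And>k. 0 < k \<Longrightarrow> state k = state 0 \<Longrightarrow> cf_period_length s \<le> k"
proof -
  have eq: "cf_period_length s = (LEAST l. l > 0 \<and> state l = state 0)"
    unfolding cf_period_length_def term_period_iff_state_period ..
  obtain L where "L > 0 \<and> state L = state 0"
    using period_exists by blast
  from LeastI[of "\<lambda>l. l > 0 \<and> state l = state 0", OF this]
  show "cf_period_length s > 0" "state (cf_period_length s) = state 0"
    unfolding eq by auto
  show "\<And>k. 0 < k \<Longrightarrow> state k = state 0 \<Longrightarrow> cf_period_length s \<le> k"
    unfolding eq by (rule Least_le) simp
qed

section \<open>The centre of the period\<close>

text \<open>
  If \<open>l = 2m + 1\<close>, reflection maps the index \<open>m + 1\<close> to itself.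
\<close>

lemma odd_period_sum_two_squares:
  assumes "odd (cf_period_length s)"
  obtains P B where "d = P\<^sup>2 + B\<^sup>2"
proof -
  obtain m where m: "cf_period_length s = 2 * m + 1"
    using assms by (auto elim: oddE)
  obtain A P B where t: "state (Suc m) = (A, P, B)" by (cases "state (Suc m)")
  have "cf_period_length s - m = Suc m" and "m \<le> cf_period_length s"
    using m by simp_all
  then have "state (Suc m) = reversal (state (Suc m))"
    using state_reflection[OF cf_period_length_sqrt(2)] by metis
  then have "A = B"
    unfolding t reversal.simps prod.inject by blast
  moreover have "A * B = d - P\<^sup>2"
    using reduced_state[of "Suc m"] by (simp add: t)
  ultimately show ?thesis
    using that[of P B] by (simp add: power2_eq_square)
qed

text \<open>
  If \<open>l = 2m\<close>, reflection exchanges the indices \<open>m\<close> and \<open>m + 1\<close>, so the middle entry \<open>P\<close> is unchanged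
  by the step and \<open>P = a\<^sub>m B - P\<close>. The denominator 1 occurs only at multiples of the period.
\<close>

lemma even_period_centre:
  assumes "even (cf_period_length s)"
  obtains A P B where "reduced (A, P, B)" "B \<noteq> 1"
    "2 * P = cf_term s (cf_period_length s div 2) * B"
proof -
  define l where "l = cf_period_length s"
  define m where "m = l div 2"
  have l: "l = 2 * m" and m: "m \<ge> 1" "m < l"
    using assms cf_period_length_sqrt(1) by (auto simp: m_def l_def)
  obtain A P B where t: "state m = (A, P, B)" by (cases "state m")
  obtain P' B' where st: "state (Suc m) = (B, P', B')"
    and P': "P' = (P + r) div B * B - P"
    using step_reduced[of A P B] reduced_state[of m] unfolding t state_Suc by metis
  have "state m = reversal (state (Suc m))"
    using state_reflection[OF cf_period_length_sqrt(2), of m] l by (simp add: l_def)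
  then have "2 * P = (P + r) div B * B"
    using P' by (simp add: t st)
  also have "(P + r) div B = cf_term s m"
    using m by (simp add: cf_term_sqrt partial_quotient_def t)
  finally have centre: "2 * P = cf_term s m * B" .
  have red: "reduced (A, P, B)"
    using reduced_state[of m] t by simp
  \<comment> \<open>For \<open>B = 1\<close> the window \<open>r - B < P \<le> r\<close> forces \<open>P = r\<close>, which is the initial state.\<close>
  have "B \<noteq> 1"
  proof
    assume "B = 1"
    then have "state m = state 0"
      using red t by (auto simp: state_def)
    then show False
      using cf_period_length_sqrt(3)[of m] m by (simp add: l_def)
  qed
  then show ?thesis
    using that red centre by (simp add: m_def l_def)
qed

end

section \<open>Prime radicands\<close>

lemma prime_sqrt_not_int:
  assumes "prime (p :: nat)"
  shows "sqrt (real p) \<notin> \<int>"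
proof
  assume "sqrt (real p) \<in> \<int>"
  then obtain k where k: "sqrt (real p) = of_int k" by (auto elim: Ints_cases)
  have "real p = (sqrt (real p))\<^sup>2"
    by simp
  also have "\<dots> = (of_int k)\<^sup>2"
    by (simp only: k)
  finally have "real p = of_int (k\<^sup>2)" by simp
  then have "int p = k\<^sup>2" by linarith
  then have "int p = int (nat \<bar>k\<bar> ^ 2)"
    by simp
  then have "p = nat \<bar>k\<bar> ^ 2"
    by (simp only: of_nat_eq_iff)
  then show False
    using assms by (simp add: prime_power_iff)
qed

text \<open>
  The equation \<open>4 p = (2 P)\<^sup>2 + 4 A B\<close> shows that \<open>B\<close> divides \<open>4 p\<close>. As \<open>0 < P < p\<close>, the prime \<open>p\<close>
  does not divide \<open>2 P\<close> and hence not \<open>B\<close>, so \<open>B\<close> divides 4. Finally \<open>B = 4\<close> would make \<open>P\<close> even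
  and \<open>p\<close> divisible by 4.
\<close>

lemma central_denominator:
  fixes p P A B a :: int
  assumes "prime p" "[p = 3] (mod 4)"
    and p_eq: "p = P\<^sup>2 + A * B" and "0 < A" "0 < B" "B \<noteq> 1" "P > 0"
    and centre: "2 * P = a * B"
  shows "B = 2" "odd P"
proof -
  have p_mod: "p mod 4 = 3"
    using assms(2) by (simp add: cong_def)
  have "P\<^sup>2 < p"
    using p_eq assms by simp
  moreover have "P \<le> P\<^sup>2"
    using \<open>P > 0\<close> by (simp add: power2_eq_square)
  ultimately have "\<not> p dvd P"
    using \<open>P > 0\<close> zdvd_imp_le[of p P] by linarith
  moreover have "\<not> p dvd 2"
    using zdvd_imp_le[of p 2] prime_ge_2_int[OF \<open>prime p\<close>] p_mod by auto
  ultimately have "\<not> p dvd 2 * P"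
    using \<open>prime p\<close> by (simp add: prime_dvd_mult_iff)
  then have "\<not> p dvd B"
    unfolding centre by (metis dvd_mult)
  then have "coprime B p"
    using \<open>prime p\<close> prime_imp_coprime coprime_commute by blast
  moreover have "B dvd 4 * p"
  proof
    have "4 * p = (2 * P)\<^sup>2 + 4 * (A * B)"
      by (simp add: p_eq power_mult_distrib)
    then show "4 * p = B * (a\<^sup>2 * B + 4 * A)"
      unfolding centre by (simp add: power2_eq_square algebra_simps)
  qed
  ultimately have "B dvd 4"
    by (simp add: coprime_dvd_mult_left_iff)
  then have "B \<le> 4"
    by (simp add: zdvd_imp_le)
  then have "B = 2 \<or> B = 3 \<or> B = 4"
    using \<open>0 < B\<close> \<open>B \<noteq> 1\<close> by linarith
  moreover have "B \<noteq> 3"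
    using \<open>B dvd 4\<close> by auto
  moreover have "B \<noteq> 4"
  proof
    assume "B = 4"
    then have "P = 2 * a"
      using centre by simp
    then have "p = 4 * (a\<^sup>2 + A)"
      by (simp add: p_eq \<open>B = 4\<close> power_mult_distrib)
    then show False
      using p_mod by simp
  qed
  ultimately show B: "B = 2" by blast
  have "odd p"
    using p_mod by presburger
  then show "odd P"
    using p_eq by (simp add: B)
qed

lemma sum_two_squares_mod_4:
  fixes x y :: int
  shows "(x\<^sup>2 + y\<^sup>2) mod 4 \<noteq> 3"
proof -
  have "z\<^sup>2 mod 4 = 0 \<or> z\<^sup>2 mod 4 = 1" for z :: int
  proof (cases "even z")
    case True
    then show ?thesis by (auto elim!: evenE simp: power_mult_distrib)
  next
    case False
    then obtain k where "z = 2 * k + 1" by (auto elim: oddE)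
    then have "z\<^sup>2 = 4 * (k\<^sup>2 + k) + 1" by algebra
    then show ?thesis by presburger
  qed
  from this[of x] this[of y] show ?thesis by presburger
qed

theorem corollary3p4:
  fixes p l :: nat and n :: int and a :: "nat \<Rightarrow> int"
  assumes "prime p"
    and "[p = 3] (mod 4)"
    and "n = \<lfloor>sqrt (real p)\<rfloor>"
    and "a = cf_term (sqrt (real p))"
    and "l = cf_period_length (sqrt (real p))"
  shows "even l \<and> odd (a (l div 2)) \<and> (a (l div 2) = n \<or> a (l div 2) = n - 1)"
proof -
  interpret sqrt_cf "int p"
    using prime_sqrt_not_int[OF assms(1)] by unfold_locales simp_all
  have p: "prime (int p)" "[int p = 3] (mod 4)"
    using assms(1,2) cong_int_iff[of p 3 4] by simp_all
  have "even l"
  proof (rule ccontr)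
    assume "odd l"
    then obtain P B where "int p = P\<^sup>2 + B\<^sup>2"
      using odd_period_sum_two_squares assms(5) by auto
    then show False
      using p(2) sum_two_squares_mod_4[of P B] by (simp add: cong_def)
  qed
  then obtain A P B where red: "reduced (A, P, B)" and "B \<noteq> 1"
    and centre: "2 * P = a (l div 2) * B"
    using even_period_centre assms(4,5) by auto
  have "B = 2" "odd P"
    using central_denominator[OF p, of P A B] red \<open>B \<noteq> 1\<close> centre reduced_pos[OF red]
    by auto
  then have "a (l div 2) = P"
    using centre by simp
  moreover have "P \<le> r" "r < P + 2"
    using red \<open>B = 2\<close> by auto
  moreover have "n = r"
    using assms(3) by (simp add: r_def)
  ultimately show ?thesis
    using \<open>even l\<close> \<open>odd P\<close> by auto
qed

end
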